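(* Let $I$ be a non-trivial admissible ideal on $\mathbb{N}$, let $D\subset\mathbb{R}$, let $f:D\to\mathbb{R}$, and let $x\in D$. If $f$ is rough $I$-continuous at $x$, then $f$ is rough continuous at $x$.
   Context: An ideal on $\mathbb{N}$ is a collection $I$ of subsets of $\mathbb{N}$ such that $A,B\in I$ implies $A\cup B\in I$, and $A\in I$, $B\subset A$ implies $B\in I$. It is non-trivial if $I\ne\emptyset$ and $\mathbb{N}\notin I$, and admissible if $\{n\}\in I$ for every $n\in\mathbb{N}$. Let $\{y_n\}_{n\in\mathbb{N}}$ be a real sequence, $y\in\mathbb{R}$ and $r\ge 0$ a real number. The sequence is rough convergent of roughness degree $r$ to $y$ if for every $\varepsilon>0$ there is $N\in\mathbb{N}$ with $|y_n-y|<r+\varepsilon$ for all $n\ge N$. It is rough $I$-convergent of roughness degree $r$ to $y$ if $\{n\in\mathbb{N}:|y_n-y|\ge r+\varepsilon\}\in I$ for every $\varepsilon>0$. It is $I$-convergent to $y$ if it is rough $I$-convergent of roughness degree $0$ to $y$. A function $f:D\to\mathbb{R}$ is rough continuous at $x\in D$ if there is a real number $r\ge 0$ such that for every sequence $\{x_n\}\subset D$ converging to $x$, $\{f(x_n)\}$ is rough convergent of roughness degree $r$ to $f(x)$. It is rough $I$-continuous at $x\in D$ if there is a real number $r\ge 0$ such that for every sequence $\{x_n\}\subset D$ that is $I$-convergent to $x$, $\{f(x_n)\}$ is rough $I$-convergent of roughness degree $r$ to $f(x)$. *)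

theory Defs
  imports Complex_Main
begin

definition ideal_on_nat :: "nat set set \<Rightarrow> bool" where
  "ideal_on_nat I \<longleftrightarrow>
     (\<forall>A B. A \<in> I \<longrightarrow> B \<in> I \<longrightarrow> A \<union> B \<in> I) \<and>
     (\<forall>A B. A \<in> I \<longrightarrow> B \<subseteq> A \<longrightarrow> B \<in> I)"

definition nontrivial_ideal :: "nat set set \<Rightarrow> bool" where
  "nontrivial_ideal I \<longleftrightarrow> ideal_on_nat I \<and> I \<noteq> {} \<and> UNIV \<notin> I"

definition admissible_ideal :: "nat set set \<Rightarrow> bool" where
  "admissible_ideal I \<longleftrightarrow> ideal_on_nat I \<and> (\<forall>n. {n} \<in> I)"

definition rough_convergent :: "real \<Rightarrow> (nat \<Rightarrow> real) \<Rightarrow> real \<Rightarrow> bool" where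
  "rough_convergent r y l \<longleftrightarrow> (\<forall>\<epsilon>>0. \<exists>N. \<forall>n\<ge>N. \<bar>y n - l\<bar> < r + \<epsilon>)"

definition rough_I_convergent ::
    "nat set set \<Rightarrow> real \<Rightarrow> (nat \<Rightarrow> real) \<Rightarrow> real \<Rightarrow> bool" where
  "rough_I_convergent I r y l \<longleftrightarrow> (\<forall>\<epsilon>>0. {n. \<bar>y n - l\<bar> \<ge> r + \<epsilon>} \<in> I)"

definition I_convergent :: "nat set set \<Rightarrow> (nat \<Rightarrow> real) \<Rightarrow> real \<Rightarrow> bool" where
  "I_convergent I y l \<longleftrightarrow> rough_I_convergent I 0 y l"

(* A function from D to the reals is a total function on the reals of which only
   the values on D are used; the notions below are meant for x in D. *)

definition rough_continuous_at :: "real set \<Rightarrow> (real \<Rightarrow> real) \<Rightarrow> real \<Rightarrow> bool" where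
  "rough_continuous_at D f x \<longleftrightarrow>
     (\<exists>r\<ge>0. \<forall>s :: nat \<Rightarrow> real. (\<forall>n. s n \<in> D) \<longrightarrow> s \<longlonglongrightarrow> x \<longrightarrow>
        rough_convergent r (\<lambda>n. f (s n)) (f x))"

definition rough_I_continuous_at ::
    "nat set set \<Rightarrow> real set \<Rightarrow> (real \<Rightarrow> real) \<Rightarrow> real \<Rightarrow> bool" where
  "rough_I_continuous_at I D f x \<longleftrightarrow>
     (\<exists>r\<ge>0. \<forall>s :: nat \<Rightarrow> real. (\<forall>n. s n \<in> D) \<longrightarrow> I_convergent I s x \<longrightarrow>
        rough_I_convergent I r (\<lambda>n. f (s n)) (f x))"

end

(* A subsequence of f (s n) that stays at distance at least r + \<epsilon> from f x is excluded by
   rough I-continuity: the corresponding subsequence of s still converges to x, hence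
   I-converges to x, and the exceptional set of indices would be all of \<nat>. So the
   same roughness degree r works for ordinary convergence. *)

theory Submission
  imports Defs
begin

text \<open>The empty set lies in \<open>I\<close> as a subset of a singleton; unions with
  singletons then give every other finite set.\<close>

lemma finite_in_admissible_ideal:
  assumes "admissible_ideal I" "finite A"
  shows "A \<in> I"
  using assms(2)
proof (induction A rule: finite_induct)
  case empty
  then show ?case
    using assms(1) unfolding admissible_ideal_def ideal_on_nat_def by blast
next
  case (insert a A)
  then have "{a} \<union> A \<in> I"
    using assms(1) unfolding admissible_ideal_def ideal_on_nat_def by blast
  then show ?case by simp
qed

text \<open>Only finitely many terms of a convergent sequence stay at distance
  \<open>\<epsilon>\<close> or more from the limit, and \<open>I\<close> contains all finite
  sets.\<close>

lemma LIMSEQ_imp_I_convergent: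
  assumes "admissible_ideal I" "s \<longlonglongrightarrow> x"
  shows "I_convergent I s x"
  unfolding I_convergent_def rough_I_convergent_def
proof (intro allI impI)
  fix \<epsilon> :: real
  assume "\<epsilon> > 0"
  then obtain N where "\<And>n. n \<ge> N \<Longrightarrow> \<bar>s n - x\<bar> < \<epsilon>"
    using LIMSEQ_D[OF assms(2)] by auto
  then have "{n. \<bar>s n - x\<bar> \<ge> 0 + \<epsilon>} \<subseteq> {..<N}"
    by (force simp: not_less[symmetric])
  then show "{n. \<bar>s n - x\<bar> \<ge> 0 + \<epsilon>} \<in> I"
    by (intro finite_in_admissible_ideal[OF assms(1)] finite_subset[OF _ finite_lessThan])
qed

theorem theorem4p1:
  fixes I :: "nat set set" and D :: "real set" and f :: "real \<Rightarrow> real" and x :: real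
  assumes "nontrivial_ideal I"
    and "admissible_ideal I"
    and "x \<in> D"
    and "rough_I_continuous_at I D f x"
  shows "rough_continuous_at D f x"
proof -
  obtain r where "r \<ge> 0" and r: "\<And>s. \<lbrakk>\<forall>n. s n \<in> D; I_convergent I s x\<rbrakk>
      \<Longrightarrow> rough_I_convergent I r (\<lambda>n. f (s n)) (f x)"
    using assms(4) unfolding rough_I_continuous_at_def by blast
  have "rough_convergent r (\<lambda>n. f (s n)) (f x)" if D: "\<forall>n. s n \<in> D" and lim: "s \<longlonglongrightarrow> x" for s
  proof (rule ccontr)
    assume "\<not> rough_convergent r (\<lambda>n. f (s n)) (f x)"
    then obtain \<epsilon> where "\<epsilon> > 0" and "\<forall>N. \<exists>n\<ge>N. r + \<epsilon> \<le> \<bar>f (s n) - f x\<bar>"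
      unfolding rough_convergent_def by (auto simp: not_less)
    \<comment> \<open>The bad indices of \<open>s\<close> form an infinite set, which may still
      belong to \<open>I\<close>. After reindexing by \<open>g\<close> every index is bad, and
      \<open>UNIV\<close> cannot belong to \<open>I\<close>.\<close>
    then obtain g where g: "\<And>N. g N \<ge> N" "\<And>N. r + \<epsilon> \<le> \<bar>f (s (g N)) - f x\<bar>"
      by metis
    \<comment> \<open>\<open>g\<close> may repeat values and need not be monotone;
      \<open>g N \<ge> N\<close> alone makes it tend to infinity, which suffices for
      \<open>s (g n)\<close> to inherit the limit \<open>x\<close>.\<close>
    have "filterlim g sequentially sequentially"
      using g(1) by (intro filterlim_at_top_mono[OF filterlim_ident]) simp
    then have "(\<lambda>n. s (g n)) \<longlonglongrightarrow> x"
      by (rule filterlim_compose[OF lim])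
    then have "rough_I_convergent I r (\<lambda>n. f (s (g n))) (f x)"
      using r[of "\<lambda>n. s (g n)"] D LIMSEQ_imp_I_convergent[OF assms(2)] by blast
    then have "UNIV \<in> I"
      using \<open>\<epsilon> > 0\<close> g(2) unfolding rough_I_convergent_def by auto
    then show False
      using assms(1) unfolding nontrivial_ideal_def by blast
  qed
  then show ?thesis
    using \<open>r \<ge> 0\<close> unfolding rough_continuous_at_def by blast
qed

end
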